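(* Let $\pi$ be a proof strategy with initial capital $\delta$. Then the probability that the theory $T$ built by $\pi$ contains some false statement (i.e., a statement false in the standard model of arithmetic) is at most $\delta$.
   Context: $\mathsf{PA}$ denotes Peano arithmetic. For a finite set $A$ of natural numbers, a rational $\tau>0$ and an arithmetical formula $R(x)$ with one free variable, $(\forall_\tau x\in A)R(x)$ denotes the arithmetical statement "the proportion of elements $n$ of $A$ such that $\lnot R(n)$ holds is at most $\tau$"; here $A$ is represented by a formula $A(x)$ such that $\mathsf{PA}\vdash A(\bar n)$ for $n\in A$, $\mathsf{PA}\vdash \lnot A(\bar n)$ for $n\notin A$, and the cardinality of $A$ is provable in $\mathsf{PA}$. A proof strategy with initial capital $\varepsilon$ is a finite rooted tree whose nodes are labeled by pairs $(T,\delta)$, $T$ a set of formulas and $\delta$ a rational in $[0,1]$; the root is labeled $(\mathsf{PA},\varepsilon)$. Each non-leaf node is either deterministic: it has one child, labeled $(T\cup\{\psi\},\delta)$ where $\psi$ is obtained from $T$ by an inference rule (or is an axiom); or probabilistic: $T$ contains a formula $(\forall_\tau n\in A)R(n)$ with $\tau\le\delta$, and the node has one child for each $n\in A$, labeled $(T\cup\{R(\bar n)\},\delta-\tau)$. The strategy is identified with the random process that starts at the root and at each probabilistic node moves to a uniformly chosen child until a leaf is reached; the theory built by $\pi$ is the (random) set of formulas $T$ in the label of the leaf reached. *)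

theory Defs
  imports "HOL-Probability.Probability" "HOL-Library.Finite_Map"
begin

section \<open>The language of arithmetic\<close>

text \<open>Variables are de Bruijn indices. Every free variable of a term or formula has an index
  below \<open>fvt\<close> resp. \<open>fvb\<close> (the least such bound), so \<open>fvb \<phi> = 0\<close> means that \<open>\<phi>\<close> is a sentence,
  and \<open>fvb \<phi> \<le> 1\<close> that it has no free variable other than the one with index 0.\<close>

datatype tm = Var nat | Zero | Succ tm | Plus tm tm | Times tm tm

datatype fm = Eq tm tm | Fls | Imp fm fm | All fm

abbreviation Neg :: "fm \<Rightarrow> fm" where "Neg \<phi> \<equiv> Imp \<phi> Fls"
abbreviation Tru :: fm where "Tru \<equiv> Neg Fls"
abbreviation And :: "fm \<Rightarrow> fm \<Rightarrow> fm" where "And \<phi> \<psi> \<equiv> Neg (Imp \<phi> (Neg \<psi>))"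
abbreviation Ex :: "fm \<Rightarrow> fm" where "Ex \<phi> \<equiv> Neg (All (Neg \<phi>))"

definition Conjs :: "fm list \<Rightarrow> fm" where
  "Conjs \<phi>s = foldr And \<phi>s Tru"

primrec fvt :: "tm \<Rightarrow> nat" where
  "fvt (Var i) = Suc i"
| "fvt Zero = 0"
| "fvt (Succ t) = fvt t"
| "fvt (Plus s t) = max (fvt s) (fvt t)"
| "fvt (Times s t) = max (fvt s) (fvt t)"

primrec fvb :: "fm \<Rightarrow> nat" where
  "fvb (Eq s t) = max (fvt s) (fvt t)"
| "fvb Fls = 0"
| "fvb (Imp \<phi> \<psi>) = max (fvb \<phi>) (fvb \<psi>)"
| "fvb (All \<phi>) = fvb \<phi> - 1"

definition univ_closure :: "fm \<Rightarrow> fm" where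
  "univ_closure \<phi> = (All ^^ fvb \<phi>) \<phi>"

primrec substt :: "(nat \<Rightarrow> tm) \<Rightarrow> tm \<Rightarrow> tm" where
  "substt \<sigma> (Var i) = \<sigma> i"
| "substt \<sigma> Zero = Zero"
| "substt \<sigma> (Succ t) = Succ (substt \<sigma> t)"
| "substt \<sigma> (Plus s t) = Plus (substt \<sigma> s) (substt \<sigma> t)"
| "substt \<sigma> (Times s t) = Times (substt \<sigma> s) (substt \<sigma> t)"

definition under_binder :: "(nat \<Rightarrow> tm) \<Rightarrow> nat \<Rightarrow> tm" where
  "under_binder \<sigma> = case_nat (Var 0) (\<lambda>i. substt (\<lambda>j. Var (Suc j)) (\<sigma> i))"

primrec subst :: "(nat \<Rightarrow> tm) \<Rightarrow> fm \<Rightarrow> fm" where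
  "subst \<sigma> (Eq s t) = Eq (substt \<sigma> s) (substt \<sigma> t)"
| "subst \<sigma> Fls = Fls"
| "subst \<sigma> (Imp \<phi> \<psi>) = Imp (subst \<sigma> \<phi>) (subst \<sigma> \<psi>)"
| "subst \<sigma> (All \<phi>) = All (subst (under_binder \<sigma>) \<phi>)"

definition lift :: "fm \<Rightarrow> fm" where
  "lift \<phi> = subst (\<lambda>i. Var (Suc i)) \<phi>"

text \<open>\<open>inst \<phi> t\<close> is \<open>\<phi>(t)\<close>, where \<open>\<phi>(x)\<close> has \<open>x\<close> at index 0; the remaining indices move down.\<close>

definition inst :: "fm \<Rightarrow> tm \<Rightarrow> fm" where
  "inst \<phi> t = subst (case_nat t Var) \<phi>"

definition numeral_tm :: "nat \<Rightarrow> tm" where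
  "numeral_tm n = (Succ ^^ n) Zero"


section \<open>Truth in the standard model\<close>

primrec evalt :: "(nat \<Rightarrow> nat) \<Rightarrow> tm \<Rightarrow> nat" where
  "evalt e (Var i) = e i"
| "evalt e Zero = 0"
| "evalt e (Succ t) = Suc (evalt e t)"
| "evalt e (Plus s t) = evalt e s + evalt e t"
| "evalt e (Times s t) = evalt e s * evalt e t"

primrec sat :: "(nat \<Rightarrow> nat) \<Rightarrow> fm \<Rightarrow> bool" where
  "sat e (Eq s t) \<longleftrightarrow> evalt e s = evalt e t"
| "sat e Fls \<longleftrightarrow> False"
| "sat e (Imp \<phi> \<psi>) \<longleftrightarrow> (sat e \<phi> \<longrightarrow> sat e \<psi>)"
| "sat e (All \<phi>) \<longleftrightarrow> (\<forall>n. sat (case_nat n e) \<phi>)"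

text \<open>As usual, a formula with free variables is true if its universal closure is.\<close>

definition true_in_N :: "fm \<Rightarrow> bool" where
  "true_in_N \<phi> \<longleftrightarrow> (\<forall>e. sat e \<phi>)"

definition false_in_N :: "fm \<Rightarrow> bool" where
  "false_in_N \<phi> \<longleftrightarrow> \<not> true_in_N \<phi>"


section \<open>Peano arithmetic\<close>

text \<open>A Hilbert calculus for first-order logic with equality, with modus ponens and
  generalisation as its rules.\<close>

inductive_set logical_axioms :: "fm set" where
  "Imp \<phi> (Imp \<psi> \<phi>) \<in> logical_axioms"
| "Imp (Imp \<phi> (Imp \<psi> \<theta>)) (Imp (Imp \<phi> \<psi>) (Imp \<phi> \<theta>)) \<in> logical_axioms"
| "Imp (Neg (Neg \<phi>)) \<phi> \<in> logical_axioms"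
| "Imp (All \<phi>) (inst \<phi> t) \<in> logical_axioms"
| "Imp (All (Imp (lift \<phi>) \<psi>)) (Imp \<phi> (All \<psi>)) \<in> logical_axioms"
| "Eq t t \<in> logical_axioms"
| "Imp (Eq s t) (Imp (inst \<phi> s) (inst \<phi> t)) \<in> logical_axioms"

inductive inferred_from :: "fm set \<Rightarrow> fm \<Rightarrow> bool" for T where
  logical_axiom: "\<phi> \<in> logical_axioms \<Longrightarrow> inferred_from T \<phi>"
| modus_ponens: "Imp \<phi> \<psi> \<in> T \<Longrightarrow> \<phi> \<in> T \<Longrightarrow> inferred_from T \<psi>"
| generalisation: "\<phi> \<in> T \<Longrightarrow> inferred_from T (All \<phi>)"

inductive proves :: "fm set \<Rightarrow> fm \<Rightarrow> bool" (infix "\<turnstile>" 50) for T where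
  assumption: "\<phi> \<in> T \<Longrightarrow> T \<turnstile> \<phi>"
| inference: "(\<And>\<psi>. \<psi> \<in> S \<Longrightarrow> T \<turnstile> \<psi>) \<Longrightarrow> inferred_from S \<phi> \<Longrightarrow> T \<turnstile> \<phi>"

text \<open>In the induction axiom the induction variable has index 0 in \<open>\<phi>\<close>; the other free
  variables of \<open>\<phi>\<close> are parameters.\<close>

definition induction_axiom :: "fm \<Rightarrow> fm" where
  "induction_axiom \<phi> =
     Imp (inst \<phi> Zero)
       (Imp (All (Imp \<phi> (subst (case_nat (Succ (Var 0)) (\<lambda>i. Var (Suc i))) \<phi>)))
         (All \<phi>))"

definition PA :: "fm set" where
  "PA = univ_closure `
     ({Neg (Eq Zero (Succ (Var 0))),
       Imp (Eq (Succ (Var 0)) (Succ (Var 1))) (Eq (Var 0) (Var 1)),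
       Eq (Plus (Var 0) Zero) (Var 0),
       Eq (Plus (Var 0) (Succ (Var 1))) (Succ (Plus (Var 0) (Var 1))),
       Eq (Times (Var 0) Zero) Zero,
       Eq (Times (Var 0) (Succ (Var 1))) (Plus (Times (Var 0) (Var 1)) (Var 0))}
      \<union> range induction_axiom)"


section \<open>The quantifier \<open>\<forall>\<^sub>\<tau> x \<in> A\<close>\<close>

text \<open>\<open>at_least k \<phi>\<close> says that there are pairwise distinct \<open>x\<^sub>0, \<dots>, x\<^sub>k\<^sub>-\<^sub>1\<close> with
  \<open>\<phi>(x\<^sub>i)\<close> for all \<open>i\<close>. Below the \<open>k\<close> quantifiers, \<open>x\<^sub>i\<close> is \<open>Var i\<close> and the other free
  variables of \<open>\<phi>\<close> are shifted by \<open>k\<close>.\<close>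

definition at_least :: "nat \<Rightarrow> fm \<Rightarrow> fm" where
  "at_least k \<phi> =
     (Ex ^^ k) (And
       (Conjs [Neg (Eq (Var i) (Var j)). j \<leftarrow> [0..<k], i \<leftarrow> [0..<j]])
       (Conjs [subst (case_nat (Var i) (\<lambda>m. Var (m + k))) \<phi>. i \<leftarrow> [0..<k]]))"

definition at_most :: "nat \<Rightarrow> fm \<Rightarrow> fm" where
  "at_most k \<phi> = Neg (at_least (Suc k) \<phi>)"

definition exactly :: "nat \<Rightarrow> fm \<Rightarrow> fm" where
  "exactly k \<phi> = And (at_least k \<phi>) (at_most k \<phi>)"

definition represents :: "fm \<Rightarrow> nat set \<Rightarrow> bool" where
  "represents \<alpha> A \<longleftrightarrow>
     finite A \<and> fvb \<alpha> \<le> 1 \<and>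
     (\<forall>n\<in>A. PA \<turnstile> inst \<alpha> (numeral_tm n)) \<and>
     (\<forall>n. n \<notin> A \<longrightarrow> PA \<turnstile> Neg (inst \<alpha> (numeral_tm n))) \<and>
     PA \<turnstile> exactly (card A) \<alpha>"

text \<open>For \<open>A\<close> with \<open>N\<close> elements, represented by \<open>\<alpha>\<close>, the proportion of the \<open>n \<in> A\<close> with
  \<open>\<not> R(n)\<close> is at most \<open>\<tau>\<close> iff there are at most \<open>\<lfloor>\<tau> N\<rfloor>\<close> such \<open>n\<close>.\<close>

definition forall_prop :: "rat \<Rightarrow> nat \<Rightarrow> fm \<Rightarrow> fm \<Rightarrow> fm" where
  "forall_prop \<tau> N \<alpha> R = at_most (nat \<lfloor>\<tau> * of_nat N\<rfloor>) (And \<alpha> (Neg R))"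


section \<open>Proof strategies\<close>

text \<open>The children of a probabilistic node are indexed by the elements of the finite set \<open>A\<close>,
  which is the domain of the finite map. It is nonempty, so that a uniform choice is possible.\<close>

datatype strategy =
    Leaf "fm set" rat
  | Deterministic "fm set" rat strategy
  | Probabilistic "fm set" rat "(nat, strategy) fmap"

primrec label :: "strategy \<Rightarrow> fm set \<times> rat" where
  "label (Leaf T \<delta>) = (T, \<delta>)"
| "label (Deterministic T \<delta> c) = (T, \<delta>)"
| "label (Probabilistic T \<delta> cs) = (T, \<delta>)"

inductive correct :: "strategy \<Rightarrow> bool" where
  leaf: "0 \<le> \<delta> \<Longrightarrow> \<delta> \<le> 1 \<Longrightarrow> correct (Leaf T \<delta>)"
| deterministic:
    "0 \<le> \<delta> \<Longrightarrow> \<delta> \<le> 1 \<Longrightarrow>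
     inferred_from T \<psi> \<or> \<psi> \<in> PA \<Longrightarrow>
     label c = (T \<union> {\<psi>}, \<delta>) \<Longrightarrow> correct c \<Longrightarrow>
     correct (Deterministic T \<delta> c)"
| probabilistic:
    "0 \<le> \<delta> \<Longrightarrow> \<delta> \<le> 1 \<Longrightarrow>
     A = fset (fmdom cs) \<Longrightarrow> A \<noteq> {} \<Longrightarrow>
     represents \<alpha> A \<Longrightarrow> fvb R \<le> 1 \<Longrightarrow>
     0 < \<tau> \<Longrightarrow> \<tau> \<le> \<delta> \<Longrightarrow>
     forall_prop \<tau> (card A) \<alpha> R \<in> T \<Longrightarrow>
     (\<And>n c. fmlookup cs n = Some c \<Longrightarrow>
        label c = (T \<union> {inst R (numeral_tm n)}, \<delta> - \<tau>) \<and> correct c) \<Longrightarrow>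
     correct (Probabilistic T \<delta> cs)"

definition proof_strategy :: "rat \<Rightarrow> strategy \<Rightarrow> bool" where
  "proof_strategy \<epsilon> \<pi> \<longleftrightarrow> correct \<pi> \<and> label \<pi> = (PA, \<epsilon>)"

text \<open>The distribution of the label of the leaf in which the random process ends.\<close>

primrec run :: "strategy \<Rightarrow> (fm set \<times> rat) pmf" where
  "run (Leaf T \<delta>) = return_pmf (T, \<delta>)"
| "run (Deterministic T \<delta> c) = run c"
| "run (Probabilistic T \<delta> cs) =
     bind_pmf (pmf_of_set (fset (fmdom cs))) (\<lambda>n. the (fmlookup (fmmap run cs) n))"

definition theory_built :: "strategy \<Rightarrow> fm set pmf" where
  "theory_built \<pi> = map_pmf fst (run \<pi>)"

end

theory Submission
  imports Defs
begin

text \<open>The inference rules preserve truth in the standard model and \<open>PA\<close> is true there, so a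
  false statement can enter only at a probabilistic node. If such a node with a true theory uses
  \<open>(\<forall>\<^sub>\<tau> n \<in> A) R(n)\<close>, a uniformly chosen child adds a false \<open>R(n)\<close> with probability at most
  \<open>\<tau>\<close>, which is what the node pays out of its capital \<open>\<delta>\<close>; every other child again has a true
  theory, with capital \<open>\<delta> - \<tau>\<close>. Induction over the tree gives the bound \<open>\<tau> + (\<delta> - \<tau>) = \<delta>\<close>.\<close>

section \<open>Substitution, free variables and universal closure\<close>

lemma evalt_substt: "evalt e (substt \<sigma> t) = evalt (\<lambda>i. evalt e (\<sigma> i)) t"
  by (induction t) auto

text \<open>This is the \<open>All\<close> case of \<open>sat_subst\<close>: index 0 stays fixed and
  receives \<open>n\<close>, while the terms substituted for the other indices are shifted past the
  binder and hence do not see \<open>n\<close>.\<close>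

lemma evalt_under_binder:
  "(\<lambda>i. evalt (case_nat n e) (under_binder \<sigma> i)) = case_nat n (\<lambda>i. evalt e (\<sigma> i))"
  by (auto simp: fun_eq_iff under_binder_def evalt_substt split: nat.split)

lemma sat_subst: "sat e (subst \<sigma> \<phi>) \<longleftrightarrow> sat (\<lambda>i. evalt e (\<sigma> i)) \<phi>"
  by (induction \<phi> arbitrary: e \<sigma>) (auto simp: evalt_substt evalt_under_binder)

lemma sat_inst: "sat e (inst \<phi> t) \<longleftrightarrow> sat (case_nat (evalt e t) e) \<phi>"
proof -
  have "(\<lambda>i. evalt e (case_nat t Var i)) = case_nat (evalt e t) e"
    by (auto simp: fun_eq_iff split: nat.split)
  then show ?thesis by (simp add: inst_def sat_subst)
qed

lemma sat_lift: "sat (case_nat n e) (lift \<phi>) \<longleftrightarrow> sat e \<phi>"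
  by (simp add: lift_def sat_subst)

lemma evalt_numeral_tm [simp]: "evalt e (numeral_tm n) = n"
  by (induction n) (auto simp: numeral_tm_def)

lemma evalt_cong: "(\<And>i. i < fvt t \<Longrightarrow> e i = e' i) \<Longrightarrow> evalt e t = evalt e' t"
  by (induction t) auto

lemma sat_cong: "(\<And>i. i < fvb \<phi> \<Longrightarrow> e i = e' i) \<Longrightarrow> sat e \<phi> \<longleftrightarrow> sat e' \<phi>"
proof (induction \<phi> arbitrary: e e')
  case (Eq s t)
  then show ?case using evalt_cong[of s e e'] evalt_cong[of t e e'] by simp
next
  case (Imp \<phi> \<psi>)
  have "sat e \<phi> \<longleftrightarrow> sat e' \<phi>" "sat e \<psi> \<longleftrightarrow> sat e' \<psi>"
    by (rule Imp.IH, simp add: Imp.prems)+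
  then show ?case by simp
next
  case (All \<phi>)
  have "sat (case_nat n e) \<phi> \<longleftrightarrow> sat (case_nat n e') \<phi>" for n
    by (rule All.IH) (auto simp: All.prems split: nat.split)
  then show ?case by simp
qed simp

text \<open>Every environment is \<open>case_nat\<close> of its head and its tail, so quantifying
  over both is quantifying over all environments. This makes generalisation sound and lets the
  closures in \<open>PA\<close> be dropped.\<close>

lemma true_in_N_All [simp]: "true_in_N (All \<phi>) \<longleftrightarrow> true_in_N \<phi>"
proof
  assume *: "true_in_N (All \<phi>)"
  have "sat e \<phi>" for e
  proof -
    have "e = case_nat (e 0) (\<lambda>i. e (Suc i))"
      by (auto simp: fun_eq_iff split: nat.split)
    then show ?thesis using * by (metis true_in_N_def sat.simps(4))
  qed
  then show "true_in_N \<phi>" by (simp add: true_in_N_def)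
qed (simp add: true_in_N_def)

lemma true_in_N_univ_closure: "true_in_N (univ_closure \<phi>) \<longleftrightarrow> true_in_N \<phi>"
proof -
  have "true_in_N ((All ^^ k) \<phi>) \<longleftrightarrow> true_in_N \<phi>" for k
    by (induction k) auto
  then show ?thesis by (simp add: univ_closure_def)
qed

section \<open>Soundness of the calculus and truth of Peano arithmetic\<close>

lemma true_in_N_logical_axioms: "\<phi> \<in> logical_axioms \<Longrightarrow> true_in_N \<phi>"
  by (induction rule: logical_axioms.induct) (auto simp: true_in_N_def sat_inst sat_lift)

lemma true_in_N_inferred_from:
  assumes "inferred_from T \<phi>" "\<And>\<psi>. \<psi> \<in> T \<Longrightarrow> true_in_N \<psi>"
  shows "true_in_N \<phi>"
  using assms(1)
proof cases
  case (modus_ponens \<psi>)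
  then have "true_in_N (Imp \<psi> \<phi>)" "true_in_N \<psi>"
    using assms(2) by blast+
  then show ?thesis by (simp add: true_in_N_def)
qed (use assms(2) in \<open>auto simp: true_in_N_logical_axioms\<close>)

lemma true_in_N_induction_axiom: "true_in_N (induction_axiom \<phi>)"
proof -
  \<comment> \<open>The substitution in the induction step acts below the quantifier: it replaces
    the induction variable by its successor and leaves the parameters, which sit at indices
    \<open>Suc i\<close>, in place.\<close>
  have shift: "(\<lambda>i. evalt (case_nat n e) (case_nat (Succ (Var 0)) (\<lambda>i. Var (Suc i)) i))
      = case_nat (Suc n) e" for n e
    by (auto simp: fun_eq_iff split: nat.split)
  have "sat (case_nat n e) \<phi>"
    if "sat (case_nat 0 e) \<phi>" "\<And>n. sat (case_nat n e) \<phi> \<Longrightarrow> sat (case_nat (Suc n) e) \<phi>" for n e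
    using that by (induction n) auto
  then show ?thesis
    by (simp add: true_in_N_def induction_axiom_def sat_inst sat_subst shift)
qed

lemma true_in_N_PA: "\<phi> \<in> PA \<Longrightarrow> true_in_N \<phi>"
  unfolding PA_def
  by (elim imageE UnE insertE emptyE rangeE;
      simp add: true_in_N_univ_closure true_in_N_induction_axiom;
      simp add: true_in_N_def)

lemma true_in_N_proves:
  assumes "T \<turnstile> \<phi>" "\<And>\<psi>. \<psi> \<in> T \<Longrightarrow> true_in_N \<psi>"
  shows "true_in_N \<phi>"
  using assms(1) by induction (use assms(2) true_in_N_inferred_from in blast)+

section \<open>Counting quantifiers and the meaning of representability\<close>

lemma sat_Conjs: "sat e (Conjs \<phi>s) \<longleftrightarrow> (\<forall>\<phi>\<in>set \<phi>s. sat e \<phi>)"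
  by (induction \<phi>s) (auto simp: Conjs_def)

lemma sat_Ex_funpow:
  "sat (\<lambda>i. if i < k then f i else e (i - k)) \<phi> \<Longrightarrow> sat e ((Ex ^^ k) \<phi>)"
proof (induction k arbitrary: e)
  case (Suc k)
  \<comment> \<open>The outermost \<open>Ex\<close> takes the witness \<open>f k\<close>, since the
    \<open>k\<close> inner quantifiers push its variable to index \<open>k\<close>. The induction
    hypothesis is then used in the environment \<open>case_nat (f k) e\<close>.\<close>
  have "(\<lambda>i. if i < Suc k then f i else e (i - Suc k))
      = (\<lambda>i. if i < k then f i else case_nat (f k) e (i - k))"
  proof
    fix i
    consider "i < k" | "i = k" | m where "i = Suc k + m"
      by (metis linorder_neqE_nat Suc_leI le_iff_add)
    then show "(if i < Suc k then f i else e (i - Suc k))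
        = (if i < k then f i else case_nat (f k) e (i - k))"
      by cases (auto simp: Suc_diff_le)
  qed
  then have "sat (case_nat (f k) e) ((Ex ^^ k) \<phi>)"
    using Suc by simp
  then show ?case by auto
qed simp

text \<open>The first \<open>k\<close> values of an injective enumeration of \<open>B\<close> serve
  as the witnesses. The lemma is applied in contrapositive form, to bound the number of exceptions
  to \<open>R\<close>.\<close>

lemma sat_at_least:
  assumes "finite B" "k \<le> card B" "\<And>n. n \<in> B \<Longrightarrow> sat (case_nat n e) \<phi>"
  shows "sat e (at_least k \<phi>)"
proof -
  obtain f where f: "bij_betw f {0..<card B} B"
    using ex_bij_betw_nat_finite[OF assms(1)] by blast
  have inj: "f i \<noteq> f j" if "i < j" "j < k" for i j
    using f that assms(2) by (auto simp: bij_betw_def dest: inj_onD[where x = i and y = j])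
  have mem: "f i \<in> B" if "i < k" for i
    using f that assms(2) by (auto simp: bij_betw_def)
  let ?e = "\<lambda>i. if i < k then f i else e (i - k)"
  have shift: "(\<lambda>j. evalt ?e (case_nat (Var i) (\<lambda>m. Var (m + k)) j)) = case_nat (f i) e"
    if "i < k" for i
    using that by (auto simp: fun_eq_iff split: nat.split)
  show ?thesis
    unfolding at_least_def
    by (rule sat_Ex_funpow[where f = f])
      (auto simp: sat_Conjs sat_subst shift inj assms(3) mem)
qed

text \<open>\<open>PA\<close> decides each numeral instance of \<open>\<alpha>\<close> in agreement
  with membership in \<open>A\<close>, and what \<open>PA\<close> proves is true.\<close>

lemma sat_represents:
  assumes "represents \<alpha> A"
  shows "sat (case_nat n e) \<alpha> \<longleftrightarrow> n \<in> A"
proof -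
  have "PA \<turnstile> (if n \<in> A then inst \<alpha> (numeral_tm n) else Neg (inst \<alpha> (numeral_tm n)))"
    using assms by (simp add: represents_def)
  then have "sat e (if n \<in> A then inst \<alpha> (numeral_tm n) else Neg (inst \<alpha> (numeral_tm n)))"
    using true_in_N_proves true_in_N_PA unfolding true_in_N_def by blast
  then show ?thesis by (auto simp: sat_inst split: if_splits)
qed

text \<open>Once index 0 is fixed, the environment no longer affects \<open>R\<close>. Hence falsity
  of R(n), which only asks for one refuting environment, yields the negation of \<open>R\<close> in
  every environment.\<close>

lemma true_in_N_inst_numeral_tm:
  assumes "fvb R \<le> 1"
  shows "true_in_N (inst R (numeral_tm n)) \<longleftrightarrow> sat (case_nat n e) R"
proof -
  have "sat (case_nat n e') R \<longleftrightarrow> sat (case_nat n e) R" for e'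
    using assms by (intro sat_cong) (auto split: nat.split)
  then show ?thesis unfolding true_in_N_def sat_inst evalt_numeral_tm by blast
qed

lemma true_in_N_forall_prop:
  assumes "true_in_N (forall_prop \<tau> (card A) \<alpha> R)" "represents \<alpha> A" "fvb R \<le> 1" "0 < \<tau>"
  shows "of_nat (card {n\<in>A. false_in_N (inst R (numeral_tm n))}) \<le> \<tau> * of_nat (card A)"
proof -
  let ?B = "{n\<in>A. false_in_N (inst R (numeral_tm n))}"
  let ?k = "nat \<lfloor>\<tau> * of_nat (card A)\<rfloor>"
  have "finite ?B" using assms(2) by (simp add: represents_def)
  moreover have "sat (case_nat n e) (And \<alpha> (Neg R))" if "n \<in> ?B" for n e
    using that true_in_N_inst_numeral_tm[OF assms(3)]
    by (auto simp: sat_represents[OF assms(2)] false_in_N_def)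
  moreover have "\<not> sat e (at_least (Suc ?k) (And \<alpha> (Neg R)))" for e
    using assms(1) by (auto simp: true_in_N_def forall_prop_def at_most_def)
  ultimately have "\<not> Suc ?k \<le> card ?B"
    using sat_at_least by blast
  then have "card ?B \<le> ?k" by simp
  \<comment> \<open>Positivity of \<open>\<tau>\<close> makes the floor nonnegative, so
    \<open>nat\<close> does not truncate it.\<close>
  then have "int (card ?B) \<le> \<lfloor>\<tau> * of_nat (card A)\<rfloor>"
    using assms(4) by (simp add: le_nat_iff)
  then show ?thesis by (simp add: le_floor_iff)
qed

section \<open>Probability of reaching a false theory\<close>

lemma prob_bind_pmf_of_set:
  assumes "finite A" "A \<noteq> {}"
  shows "measure_pmf.prob (bind_pmf (pmf_of_set A) f) X
    = (\<Sum>n\<in>A. measure_pmf.prob (f n) X) / card A"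
proof -
  have "measure_pmf.prob (bind_pmf (pmf_of_set A) f) X
      = measure_pmf.expectation (pmf_of_set A) (\<lambda>n. measure_pmf.prob (f n) X)"
    unfolding measure_pmf_bind
    using measurable_measure_pmf[of f]
    by (intro measure_pmf.measure_bind[where N = "count_space UNIV"])
      (simp_all only: measurable_cong_sets[OF sets_measure_pmf_count_space refl]
        sets_count_space Pow_UNIV UNIV_I)
  then show ?thesis
    by (simp only: integral_pmf_of_set[OF assms(2,1)])
qed

text \<open>Allowing any true theory \<open>T\<close> at the root, in place of \<open>PA\<close>,
  makes the induction hypothesis applicable to the children.\<close>

lemma prob_theory_built_le:
  assumes "correct \<pi>" "label \<pi> = (T, \<delta>)" "\<And>\<phi>. \<phi> \<in> T \<Longrightarrow> true_in_N \<phi>"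
  shows "measure_pmf.prob (theory_built \<pi>) {T. \<exists>\<phi>\<in>T. false_in_N \<phi>} \<le> real_of_rat \<delta>"
  using assms
proof (induction arbitrary: T \<delta> rule: correct.induct)
  case (leaf \<delta>' T')
  then have "T' \<notin> {T. \<exists>\<phi>\<in>T. false_in_N \<phi>}"
    by (auto simp: false_in_N_def)
  then show ?case using leaf by (simp add: theory_built_def)
next
  case (deterministic \<delta>' T' \<psi> c)
  then have eqs: "T' = T" "\<delta>' = \<delta>" by auto
  have "true_in_N \<psi>"
    using deterministic.hyps(3) deterministic.prems(2) true_in_N_inferred_from true_in_N_PA
    unfolding eqs by blast
  moreover have "theory_built (Deterministic T' \<delta>' c) = theory_built c"
    by (simp add: theory_built_def)
  ultimately show ?case
    using deterministic.IH[of "T \<union> {\<psi>}" \<delta>] deterministic.hyps(4) deterministic.prems(2)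
    unfolding eqs by auto
next
  case (probabilistic \<delta>' A cs \<alpha> R \<tau> T')
  let ?F = "{T. \<exists>\<phi>\<in>T. false_in_N \<phi>}"
  let ?c = "\<lambda>n. the (fmlookup cs n)"
  let ?p = "\<lambda>n. measure_pmf.prob (theory_built (?c n)) ?F"
  let ?B = "{n\<in>A. false_in_N (inst R (numeral_tm n))}"
  have eqs: "T' = T" "\<delta>' = \<delta>" using probabilistic.prems by auto
  have A: "finite A" "A \<noteq> {}" "card A > 0"
    using probabilistic.hyps by (auto simp: card_gt_0_iff)
  have lookup: "fmlookup cs n = Some (?c n)" if "n \<in> A" for n
    using that probabilistic.hyps(3) by auto
  have map_run: "the (map_option run (fmlookup cs n)) = run (?c n)" if "n \<in> A" for n
    using lookup[OF that] by (metis option.map(2) option.sel)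
  have "theory_built (Probabilistic T' \<delta>' cs) = bind_pmf (pmf_of_set A) (\<lambda>n. theory_built (?c n))"
    unfolding theory_built_def run.simps map_bind_pmf probabilistic.hyps(3)[symmetric]
    using A by (intro bind_pmf_cong) (simp_all add: map_run)
  then have prob: "measure_pmf.prob (theory_built (Probabilistic T' \<delta>' cs)) ?F
      = (\<Sum>n\<in>A. ?p n) / card A"
    using A by (simp add: prob_bind_pmf_of_set)
  have good: "?p n \<le> real_of_rat (\<delta> - \<tau>)" if "n \<in> A - ?B" for n
  proof -
    have "n \<in> A" "true_in_N (inst R (numeral_tm n))"
      using that by (auto simp: false_in_N_def)
    with probabilistic.IH[OF lookup, of n] probabilistic.prems(2) show ?thesis
      unfolding eqs by blast
  qed
  have nonneg: "real_of_rat (\<delta> - \<tau>) \<ge> 0"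
    using probabilistic.hyps eqs by simp
  \<comment> \<open>For a child with false R(n) the trivial bound 1 suffices, because
    \<open>\<tau> \<le> \<delta>\<close> makes the first summand nonnegative. One bound thus covers
    all children, and summing it counts the bad ones.\<close>
  have "?p n \<le> real_of_rat (\<delta> - \<tau>) + indicator ?B n" if "n \<in> A" for n
  proof (cases "n \<in> ?B")
    case True
    then show ?thesis using nonneg measure_pmf.prob_le_1[of "theory_built (?c n)" ?F]
      unfolding indicator_simps(1)[OF True] by linarith
  next
    case False
    then show ?thesis using good[of n] that by simp
  qed
  then have "(\<Sum>n\<in>A. ?p n) \<le> (\<Sum>n\<in>A. real_of_rat (\<delta> - \<tau>) + indicator ?B n)"
    by (intro sum_mono)
  \<comment> \<open>The at most \<open>\<tau> * card A\<close> bad children cancel exactly the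
    capital \<open>\<tau>\<close> spent at each of the \<open>card A\<close> children.\<close>
  also have "\<dots> = card A * real_of_rat (\<delta> - \<tau>) + card (A \<inter> ?B)"
    using A(1) by (simp only: sum.distrib sum_constant indicator_def sum_of_bool_eq Collect_mem_eq)
  also have "A \<inter> ?B = ?B" by auto
  also have "card A * real_of_rat (\<delta> - \<tau>) + card ?B \<le> card A * real_of_rat \<delta>"
  proof -
    have "of_nat (card ?B) \<le> \<tau> * of_nat (card A)"
      using probabilistic.prems probabilistic.hyps eqs by (intro true_in_N_forall_prop) auto
    then have "real_of_rat (of_nat (card ?B)) \<le> real_of_rat (\<tau> * of_nat (card A))"
      by (simp only: of_rat_less_eq)
    then show ?thesis by (simp add: of_rat_mult of_rat_diff algebra_simps)
  qed
  finally have "(\<Sum>n\<in>A. ?p n) \<le> card A * real_of_rat \<delta>" .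
  then show ?case
    using A(3) unfolding prob by (simp add: pos_divide_le_eq mult.commute)
qed

theorem theorem1:
  fixes \<pi> :: strategy and \<delta> :: rat
  assumes "proof_strategy \<delta> \<pi>"
  shows "measure_pmf.prob (theory_built \<pi>) {T. \<exists>\<phi>\<in>T. false_in_N \<phi>} \<le> real_of_rat \<delta>"
  using assms true_in_N_PA by (auto simp: proof_strategy_def intro: prob_theory_built_le)

end
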